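(* (i) Let $\rho:\mathbb{R}\to\mathbb{R}_+$ be a continuous probability density with $\int_{-\infty}^{\infty}|s|\rho(s)\,ds<\infty$, and let $$\bar m_1(\eta)=\int_{-\infty}^{\infty}\max\{\eta-s,0\}\,\rho(s)\,ds=\int_{-\infty}^\eta(\eta-s)\rho(s)\,ds$$ be the convolution smoothing of $\max\{\cdot,0\}$ with density $\rho$ and smoothing parameter $\nu=1$. Then $\bar m_1$ can be written as the infimal-convolution smoothing $$\bar m_1(\eta)=\max_{0\le t\le1}\{\eta\,t-\bar d(t)\}\quad\text{where}\quad \bar d(t)=t\,Q_t(\rho)-\bar m_1(Q_t(\rho)),$$ and $Q_t(\rho)$ is the quantile function of a random variable with density $\rho$. (ii) Conversely, let $p\in(0,1)$, let $d:[0,1]\to\mathbb{R}$ be strongly convex, and let $$m_1(\eta)=\max_{0\le t\le1}\{\eta\,t-\tilde d(t)\},\qquad \tilde d(t)=n(1-p)\,d\Big(\frac{t}{n(1-p)}\Big),$$ be the infimal convolution smoothing of $\max\{\cdot,0\}$ with smoothing parameter $\nu=1$. Then $m_1$ can be written as the convolution smoothing $$m_1(\eta)=\lim_{s\to-\infty}m_1(s)+\int_{-\infty}^{\eta}(\eta-s)\,\tilde\rho(s)\,ds\quad\text{where}\quad \tilde\rho(s)=m_1''(s)\ \text{ a.e.}$$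
   Context: For $t\in(0,1)$, $Q_t(\rho)$ is the $t$-quantile: for a random variable $U$ with density $\rho$, $Q_t(\rho)\le a\iff\mathbb{P}(U\le a)\ge t$ for all $a\in\mathbb{R}$. At the endpoints $t=0$ and $t=1$, where $Q_t(\rho)$ may be infinite, $\bar d(t)$ is understood as the limit of its values on $(0,1)$. In (ii), $n\ge1$ is an integer; the maximum defining $m_1$ is understood as attained, and the segment $[0,\frac1{n(1-p)}]$ is understood to lie in the domain $[0,1]$ of $d$. *)

theory Defs
  imports "HOL-Probability.Probability"
begin

definition is_maximum :: "('a \<Rightarrow> real) \<Rightarrow> 'a set \<Rightarrow> real \<Rightarrow> bool" where
  "is_maximum f S M \<longleftrightarrow> (\<exists>x\<in>S. f x = M) \<and> (\<forall>x\<in>S. f x \<le> M)"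

definition strongly_convex_on :: "real set \<Rightarrow> (real \<Rightarrow> real) \<Rightarrow> bool" where
  "strongly_convex_on S f \<longleftrightarrow> convex S \<and>
     (\<exists>\<mu>>0. \<forall>x\<in>S. \<forall>y\<in>S. \<forall>u\<in>{0..1}.
        f (u * x + (1 - u) * y) \<le> u * f x + (1 - u) * f y - \<mu> / 2 * u * (1 - u) * (x - y)\<^sup>2)"

text \<open>The law of a random variable with density \<open>\<rho>\<close> is \<open>density lborel \<rho>\<close>. A number \<open>q\<close> with the
  defining property is unique; it exists when \<open>\<rho>\<close> is a probability density and \<open>0 < t < 1\<close>,
  and only these values of \<open>t\<close> are used.\<close>

definition quantile :: "(real \<Rightarrow> real) \<Rightarrow> real \<Rightarrow> real" where
  "quantile \<rho> t =
     (THE q. \<forall>a. q \<le> a \<longleftrightarrow> t \<le> cdf (density lborel (\<lambda>s. ennreal (\<rho> s))) a)"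

definition conv_smoothing :: "(real \<Rightarrow> real) \<Rightarrow> real \<Rightarrow> real" where
  "conv_smoothing \<rho> \<eta> = (LINT s|lborel. max (\<eta> - s) 0 * \<rho> s)"

definition conv_dual_interior :: "(real \<Rightarrow> real) \<Rightarrow> real \<Rightarrow> real" where
  "conv_dual_interior \<rho> t = t * quantile \<rho> t - conv_smoothing \<rho> (quantile \<rho> t)"

text \<open>Quantiles at \<open>t = 0\<close> and \<open>t = 1\<close> may be infinite, hence the one-sided limits from within
  the open unit interval.\<close>

definition conv_dual :: "(real \<Rightarrow> real) \<Rightarrow> real \<Rightarrow> real" where
  "conv_dual \<rho> t =
     (if t = 0 then Lim (at_right 0) (conv_dual_interior \<rho>)
      else if t = 1 then Lim (at_left 1) (conv_dual_interior \<rho>)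
      else conv_dual_interior \<rho> t)"

definition scaled_dual :: "nat \<Rightarrow> real \<Rightarrow> (real \<Rightarrow> real) \<Rightarrow> real \<Rightarrow> real" where
  "scaled_dual n p d t = real n * (1 - p) * d (t / (real n * (1 - p)))"

end

theory Submission
  imports Defs "HOL-Real_Asymp.Real_Asymp"
begin

text \<open>
  Both halves rest on the same picture: a smoothing \<open>m\<close> of \<open>max 0\<close> is a convex function
  whose slope rises from \<open>0\<close> at \<open>- \<infinity>\<close> to \<open>1\<close> at \<open>\<infinity>\<close>. For the convolution
  smoothing the slope is the distribution function of the density; for the infimal convolution
  it is the maximiser \<open>t \<eta>\<close> of \<open>\<eta> t - d t\<close>.

  For a density \<open>\<rho>\<close> with distribution function \<open>F\<close>, the kernel \<open>max (\<eta> - s) 0\<close> has the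
  indicator of \<open>s \<le> \<eta>\<close> as a subgradient in \<open>\<eta>\<close>; integrating gives the subgradient
  inequality \<open>m x + F x (y - x) \<le> m y\<close> (\<open>cdf_subgradient\<close>). Taking for \<open>x\<close> the
  \<open>t\<close>-quantile, where \<open>F\<close> has the value \<open>t\<close>, turns this into the Fenchel-Young inequality
  for the dual function of the statement, with equality at \<open>t = F \<eta>\<close>. The values \<open>0\<close> and
  the mean that the dual function takes at the end points mirror the asymptotes \<open>0\<close> and
  \<open>\<eta> - mean\<close> of \<open>m\<close>.

  For the converse, strong convexity of \<open>d\<close> makes the maximiser unique, monotone and Lipschitz
  in \<open>\<eta>\<close> (\<open>strongly_convex_conjugate_maximizer\<close>), and it is the derivative of \<open>m\<close>.
  A monotone Lipschitz function is differentiable almost everywhere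
  (\<open>AE_differentiable_mono_lipschitz\<close>) and is the integral of its derivative
  (\<open>has_integral_AE_derivative_lipschitz\<close>). Hence \<open>m''\<close> has integral \<open>1 - 0\<close>, and the
  convolution formula is integration by parts: \<open>(\<eta> - s) m'' s\<close> is almost everywhere the
  derivative of the locally Lipschitz function \<open>(\<eta> - s) m' s + m s\<close>, which is \<open>m \<eta>\<close> at
  \<open>s = \<eta>\<close> and tends to \<open>lim m\<close> as \<open>s\<close> tends to \<open>- \<infinity>\<close>.
\<close>

section \<open>Almost everywhere differentiability of monotone Lipschitz functions\<close>

text \<open>
  This replaces covering arguments below. The last point at which \<open>f\<close> is at least \<open>f a\<close>
  cannot lie before \<open>b\<close>, for from there \<open>f\<close> could be continued to the right without loss.
\<close>

lemma le_of_locally_catching_up: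
  fixes f :: "real \<Rightarrow> real"
  assumes "a \<le> b" and cont: "continuous_on {a..b} f"
    and up: "\<And>x. a \<le> x \<Longrightarrow> x < b \<Longrightarrow> \<exists>y>x. y \<le> b \<and> f x \<le> f y"
  shows "f a \<le> f b"
proof -
  define S where "S = {x \<in> {a..b}. f a \<le> f x}"
  have "closed S"
    unfolding S_def by (intro continuous_on_closed_Collect_le continuous_intros cont closed_atLeastAtMost)
  moreover have "bounded S"
    by (rule bounded_subset[of "{a..b}"]) (auto simp: S_def)
  ultimately have "compact S" by (simp add: compact_eq_bounded_closed)
  moreover have "a \<in> S" using \<open>a \<le> b\<close> by (simp add: S_def)
  ultimately obtain s where s: "s \<in> S" "\<And>x. x \<in> S \<Longrightarrow> x \<le> s"
    by (metis compact_attains_sup empty_iff)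
  show ?thesis
  proof (cases "s < b")
    case True
    then obtain y where "y > s" "y \<le> b" "f s \<le> f y" using up[of s] s(1) by (auto simp: S_def)
    then have "y \<in> S" using s(1) by (auto simp: S_def)
    with s(2) \<open>y > s\<close> show ?thesis by fastforce
  next
    case False
    with s(1) show ?thesis by (auto simp: S_def)
  qed
qed

definition mass_upto :: "real set \<Rightarrow> real \<Rightarrow> real \<Rightarrow> real" where
  "mass_upto S a x = measure lborel (S \<inter> {a..x})"

lemma mass_upto_add:
  assumes "S \<in> sets borel" "a \<le> x" "x \<le> y"
  shows "mass_upto S a y = mass_upto S a x + measure lborel (S \<inter> {x..y})"
proof -
  have fm: "S \<inter> {c..d} \<in> fmeasurable lborel" for c d
    by (subst Int_commute, rule fmeasurable_Int_fmeasurable) (use assms(1) in \<open>auto simp: fmeasurable_def emeasure_lborel_Icc_eq\<close>)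
  have "S \<inter> {a..x} \<inter> (S \<inter> {x..y}) \<in> null_sets lborel"
    by (rule null_sets_subset[of "{x}"]) (use assms in auto)
  then have "measure lborel ((S \<inter> {a..x}) \<union> (S \<inter> {x..y})) = measure lborel (S \<inter> {a..x}) + measure lborel (S \<inter> {x..y})"
    using fm by (intro measure_Un_AE) (auto dest!: AE_not_in elim!: eventually_mono)
  moreover have "(S \<inter> {a..x}) \<union> (S \<inter> {x..y}) = S \<inter> {a..y}" using assms by auto
  ultimately show ?thesis by (simp add: mass_upto_def)
qed

lemma measure_Int_interval_le:
  assumes "S \<in> sets borel" "x \<le> y"
  shows "measure lborel (S \<inter> {x..y}) \<le> y - x"
  using measure_mono_fmeasurable[of "S \<inter> {x..y}" "{x..y}" lborel] assms
  by (auto simp: fmeasurable_def)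

lemma mass_upto_self [simp]:
  assumes "S \<in> sets borel"
  shows "mass_upto S a a = 0"
  unfolding mass_upto_def
  by (rule measure_eq_0_null_sets, rule null_sets_subset[of "{a}"]) (use assms in auto)

lemma continuous_on_mass_upto:
  assumes "S \<in> sets borel"
  shows "continuous_on {a..b} (mass_upto S a)"
proof -
  have *: "\<bar>mass_upto S a y - mass_upto S a x\<bar> \<le> \<bar>y - x\<bar>" if "a \<le> x" "x \<le> y" for x y
    using mass_upto_add[OF assms that] measure_Int_interval_le[OF assms that(2)] that by auto
  have "1-lipschitz_on {a..b} (mass_upto S a)"
  proof (rule lipschitz_onI)
    fix x y assume "x \<in> {a..b}" "y \<in> {a..b}"
    then show "dist (mass_upto S a x) (mass_upto S a y) \<le> 1 * dist x y"
      using *[of x y] *[of y x] by (cases "x \<le> y") (auto simp: dist_real_def)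
  qed simp
  then show ?thesis by (rule lipschitz_on_continuous_on)
qed

text \<open>
  The function \<open>g x - q * mass_upto C a x\<close> can always be continued to the right without
  decreasing: at a point of \<open>C\<close> the steepness of \<open>g\<close> pays for the subtracted mass, which
  grows at rate at most \<open>q\<close>; away from the closed set \<open>C\<close> that mass is locally constant.
\<close>

lemma slope_times_mass_le_increment:
  fixes g :: "real \<Rightarrow> real"
  assumes "mono g" "continuous_on UNIV g" "closed C" "0 \<le> q"
    and steep: "\<And>x. x \<in> C \<Longrightarrow> \<exists>\<^sub>F h in at_right 0. q * h \<le> g (x + h) - g x"
    and "a \<le> b"
  shows "q * measure lborel (C \<inter> {a..b}) \<le> g b - g a"
proof -
  have C: "C \<in> sets borel" using \<open>closed C\<close> by simp
  let ?f = "\<lambda>x. g x - q * mass_upto C a x"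
  have "?f a \<le> ?f b"
  proof (rule le_of_locally_catching_up[OF \<open>a \<le> b\<close>])
    show "continuous_on {a..b} ?f"
      by (intro continuous_intros continuous_on_mass_upto C continuous_on_subset[OF assms(2)]) auto
    fix x assume x: "a \<le> x" "x < b"
    show "\<exists>y>x. y \<le> b \<and> ?f x \<le> ?f y"
    proof (cases "x \<in> C")
      case True
      have "\<forall>\<^sub>F h in at_right 0. h < b - x \<and> 0 < h"
        using eventually_at_right_less[of 0] x
        by (auto intro!: eventually_conj eventually_at_rightI[of 0 "b - x"])
      from frequently_eventually_frequently[OF steep[OF True] this]
      obtain h where h: "q * h \<le> g (x + h) - g x" "h < b - x" "0 < h"
        by (auto dest: frequently_ex)
      have "q * measure lborel (C \<inter> {x..x+h}) \<le> q * h"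
        using measure_Int_interval_le[OF C, of x "x+h"] h \<open>0 \<le> q\<close> by (intro mult_left_mono) auto
      then have "?f x \<le> ?f (x + h)"
        using mass_upto_add[OF C x(1), of "x+h"] h by (simp add: algebra_simps)
      with h show ?thesis by (intro exI[of _ "x+h"]) auto
    next
      case False
      then obtain e where e: "e > 0" "\<And>y. dist y x < e \<Longrightarrow> y \<notin> C"
        using \<open>closed C\<close> by (metis Compl_iff open_Compl open_dist)
      define y where "y = x + min (e/2) (b - x)"
      have y: "x < y" "y \<le> b" using e x by (auto simp: y_def)
      have "C \<inter> {x..y} = {}" using e by (auto simp: y_def dist_real_def min_def split: if_splits)
      then have "?f x \<le> ?f y"
        using mass_upto_add[OF C x(1), of y] y monoD[OF assms(1), of x y] by simp
      with y show ?thesis by auto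
    qed
  qed
  then have "q * mass_upto C a b \<le> g b - g a" using C by simp
  then show ?thesis by (simp add: mass_upto_def)
qed

text \<open>
  A weak form of the density theorem. If \<open>U\<close> is an open neighbourhood of \<open>C\<close>, then \<open>\<theta>\<close>
  times the mass of \<open>U\<close> grows at least as fast as the mass of \<open>C\<close>, so \<open>C\<close> has at most
  \<open>\<theta>\<close> times the measure of \<open>U\<close>; and the measure of \<open>U\<close> can be chosen close to that of \<open>C\<close>.
\<close>

lemma null_if_uniformly_sparse:
  assumes "compact C" "\<theta> < 1"
    and sparse: "\<And>x y. x \<le> y \<Longrightarrow> measure lborel (C \<inter> {x..y}) \<le> \<theta> * (y - x)"
  shows "measure lborel C = 0"
proof -
  have C: "C \<in> sets borel" "closed C" using \<open>compact C\<close> by (auto simp: compact_imp_closed)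
  have Cf: "C \<in> fmeasurable lborel" using emeasure_compact_finite[OF \<open>compact C\<close>] C by (auto simp: fmeasurable_def)
  have \<theta>0: "0 \<le> \<theta>" using order_trans[OF measure_nonneg sparse[of 0 1]] by simp
  obtain a b where ab: "C \<subseteq> {a..b}" "a \<le> b"
  proof -
    obtain r where "C \<subseteq> cbox (- r) r"
      using compact_imp_bounded[OF \<open>compact C\<close>] bounded_subset_cbox_symmetric by blast
    then have "C \<subseteq> {- \<bar>r\<bar>..\<bar>r\<bar>}" by auto
    with that show thesis by fastforce
  qed
  have bound: "measure lborel C \<le> \<theta> * (measure lborel C + e)" if "e > 0" for e
  proof -
    obtain U where U: "open U" "C \<subseteq> U" "emeasure lborel (U - C) < ennreal e"
      using outer_regular_lborel[OF C(1) \<open>e > 0\<close>] by auto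
    have Ub: "U \<in> sets borel" using U by simp
    have f1: "U - C \<in> fmeasurable lborel" using U C less_trans[OF U(3) ennreal_less_top]
      by (intro fmeasurableI) auto
    have f2: "U \<in> fmeasurable lborel" using fmeasurable.Un[OF f1 Cf] U(2) by (simp add: Un_absorb1 Un_commute)
    have "measure lborel U = measure lborel C + measure lborel (U - C)"
      using measurable_measure_Diff[OF f2 C(1)[folded sets_lborel] U(2)] by simp
    moreover have "measure lborel (U - C) \<le> e"
      using U(3) \<open>e > 0\<close> emeasure_eq_measure2[OF f1] measure_nonneg[of lborel "U - C"]
      by (metis ennreal_less_iff less_imp_le)
    ultimately have mU: "measure lborel U \<le> measure lborel C + e" by simp
    let ?f = "\<lambda>x. \<theta> * mass_upto U a x - mass_upto C a x"
    have "?f a \<le> ?f b"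
    proof (rule le_of_locally_catching_up[OF \<open>a \<le> b\<close>])
      show "continuous_on {a..b} ?f" by (intro continuous_intros continuous_on_mass_upto C Ub)
      fix x assume x: "a \<le> x" "x < b"
      show "\<exists>y>x. y \<le> b \<and> ?f x \<le> ?f y"
      proof (cases "x \<in> U")
        case True
        then obtain e where e: "e > 0" "\<And>y. dist y x < e \<Longrightarrow> y \<in> U"
          using \<open>open U\<close> by (metis open_dist)
        define y where "y = x + min (e/2) (b - x)"
        have y: "x < y" "y \<le> b" using e x by (auto simp: y_def)
        have "U \<inter> {x..y} = {x..y}" using e by (auto simp: y_def dist_real_def min_def split: if_splits)
        then have "mass_upto U a y = mass_upto U a x + (y - x)"
          using mass_upto_add[OF Ub x(1), of y] y by simp
        then have "\<theta> * mass_upto U a y = \<theta> * mass_upto U a x + \<theta> * (y - x)"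
          by (simp only: distrib_left)
        then have "?f x \<le> ?f y"
          using mass_upto_add[OF C(1) x(1), of y] y sparse[of x y] by simp
        with y show ?thesis by auto
      next
        case False
        then obtain e where e: "e > 0" "\<And>y. dist y x < e \<Longrightarrow> y \<notin> C"
          using \<open>closed C\<close> U(2) by (metis Compl_iff open_Compl open_dist subsetD)
        define y where "y = x + min (e/2) (b - x)"
        have y: "x < y" "y \<le> b" using e x by (auto simp: y_def)
        have "C \<inter> {x..y} = {}" using e by (auto simp: y_def dist_real_def min_def split: if_splits)
        then have "?f x \<le> ?f y"
          using mass_upto_add[OF C(1) x(1), of y] mass_upto_add[OF Ub x(1), of y] y \<theta>0
          by (simp add: algebra_simps)
        with y show ?thesis by auto
      qed
    qed
    moreover have "mass_upto C a b = measure lborel C" using ab by (simp add: mass_upto_def Int_absorb2)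
    moreover have "mass_upto U a b \<le> measure lborel U"
      unfolding mass_upto_def using f2 Ub by (intro measure_mono_fmeasurable) auto
    ultimately have "measure lborel C \<le> \<theta> * mass_upto U a b" using C Ub by simp
    also have "\<dots> \<le> \<theta> * (measure lborel C + e)"
      using \<open>mass_upto U a b \<le> _\<close> mU \<theta>0 by (intro mult_left_mono) auto
    finally show ?thesis .
  qed
  have "measure lborel C \<le> \<theta> * measure lborel C"
  proof (rule field_le_epsilon)
    fix e :: real assume e: "e > 0"
    \<comment> \<open>\<open>\<theta>\<close> times the excess of the open neighbourhood is absorbed into \<open>e\<close>.\<close>
    have "\<theta> * e \<le> e" using e \<open>\<theta> < 1\<close> by simp
    with bound[OF e] show "measure lborel C \<le> \<theta> * measure lborel C + e" by (simp add: algebra_simps)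
  qed
  then have "(1 - \<theta>) * measure lborel C \<le> 0" by (simp add: algebra_simps)
  with \<open>\<theta> < 1\<close> have "measure lborel C \<le> 0" by (simp add: mult_le_0_iff)
  then show ?thesis using measure_le_0_iff by blast
qed

text \<open>
  In terms of Dini derivates, the upper right derivate of \<open>g\<close> exceeds \<open>q\<close> only at points of
  \<open>steep_right g q\<close> and is at least \<open>q\<close> there. Frequent steep increments, unlike the derivates
  themselves, give a set that is visibly a countable intersection of open sets. Lower derivates
  of \<open>g\<close> appear as upper derivates of \<open>K * x - g x\<close>.
\<close>

definition steep_right :: "(real \<Rightarrow> real) \<Rightarrow> real \<Rightarrow> real set" where
  "steep_right g q = {x. \<exists>\<^sub>F h in at_right 0. q * h < g (x + h) - g x}"

definition steep_left :: "(real \<Rightarrow> real) \<Rightarrow> real \<Rightarrow> real set" where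
  "steep_left g q = {x. \<exists>\<^sub>F h in at_right 0. q * h < g x - g (x - h)}"

lemma steep_left_reflect: "x \<in> steep_left g q \<longleftrightarrow> - x \<in> steep_right (\<lambda>x. - g (- x)) q"
  by (simp add: steep_left_def steep_right_def algebra_simps)

lemma frequently_at_right_0:
  "(\<exists>\<^sub>F h in at_right (0::real). P h) \<longleftrightarrow> (\<forall>n::nat. \<exists>h\<in>{0<..<1 / Suc n}. P h)"
proof -
  have "(\<exists>\<^sub>F h in at_right (0::real). P h) \<longleftrightarrow> (\<forall>b>0. \<exists>h>0. h < b \<and> P h)"
    unfolding frequently_def eventually_at_right_field by auto
  also have "\<dots> \<longleftrightarrow> (\<forall>n::nat. \<exists>h\<in>{0<..<1 / Suc n}. P h)"
  proof safe
    fix b :: real assume "\<forall>n::nat. \<exists>h\<in>{0<..<1 / Suc n}. P h" "b > 0"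
    moreover then obtain n where "inverse (real (Suc n)) < b" using reals_Archimedean by blast
    ultimately show "\<exists>h>0. h < b \<and> P h"
      by (metis greaterThanLessThan_iff inverse_eq_divide less_trans)
  next
    fix n :: nat assume "\<forall>b>0. \<exists>h>0. h < b \<and> P h"
    from this[rule_format, of "1 / Suc n"] show "\<exists>h\<in>{0<..<1 / Suc n}. P h" by auto
  qed
  finally show ?thesis .
qed

lemma borel_steep_right:
  assumes "continuous_on UNIV g"
  shows "steep_right g q \<in> sets borel"
proof -
  have "open {x. q * h < g (x + h) - g x}" for h
    by (intro open_Collect_less continuous_intros continuous_on_compose2[OF assms]) auto
  then have "open (\<Union>h\<in>{0<..<1 / Suc n}. {x. q * h < g (x + h) - g x})" for n
    by blast
  then have "(\<Inter>n::nat. \<Union>h\<in>{0<..<1 / Suc n}. {x. q * h < g (x + h) - g x}) \<in> sets borel"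
    by (intro sets.countable_INT'' borel_open) auto
  moreover have "steep_right g q = (\<Inter>n::nat. \<Union>h\<in>{0<..<1 / Suc n}. {x. q * h < g (x + h) - g x})"
    unfolding steep_right_def frequently_at_right_0 by auto
  ultimately show ?thesis by simp
qed

lemma borel_steep_left:
  assumes "continuous_on UNIV g"
  shows "steep_left g q \<in> sets borel"
proof -
  have "steep_right (\<lambda>x. - g (- x)) q \<in> sets borel"
    by (intro borel_steep_right continuous_intros continuous_on_compose2[OF assms]) auto
  then have "uminus -` steep_right (\<lambda>x. - g (- x)) q \<in> sets borel"
    by (intro measurable_sets_borel[of uminus borel]) auto
  moreover have "steep_left g q = uminus -` steep_right (\<lambda>x. - g (- x)) q"
    by (auto simp: steep_left_reflect)
  ultimately show ?thesis by simp
qed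

lemma measure_lborel_uminus:
  fixes S :: "real set"
  assumes "S \<in> sets borel"
  shows "measure lborel (uminus -` S) = measure lborel S"
proof -
  have "measure lborel S = measure (distr lborel borel uminus) S" by (simp add: lborel_distr_uminus)
  also have "\<dots> = measure lborel (uminus -` S)" using assms by (subst measure_distr) auto
  finally show ?thesis ..
qed

lemma steep_mass_le_increment:
  fixes g :: "real \<Rightarrow> real"
  assumes "mono g" "continuous_on UNIV g" "closed C" "0 \<le> q"
    and steep: "C \<subseteq> steep_right g q \<or> C \<subseteq> steep_left g q"
    and "a \<le> b"
  shows "q * measure lborel (C \<inter> {a..b}) \<le> g b - g a"
  using steep
proof
  assume "C \<subseteq> steep_right g q"
  then show ?thesis
    using assms by (intro slope_times_mass_le_increment)
      (auto simp: steep_right_def elim!: frequently_elim1 dest!: subsetD)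
next
  assume L: "C \<subseteq> steep_left g q"
  have "q * measure lborel (uminus -` C \<inter> {- b..- a}) \<le> - g (- (- a)) - - g (- (- b))"
  proof (rule slope_times_mass_le_increment)
    show "mono (\<lambda>x. - g (- x))" using \<open>mono g\<close> by (auto simp: mono_def)
    show "continuous_on UNIV (\<lambda>x. - g (- x))"
      by (intro continuous_intros continuous_on_compose2[OF assms(2)]) auto
    show "closed (uminus -` C)" using \<open>closed C\<close> by (intro closed_vimage continuous_intros)
    fix x assume "x \<in> uminus -` C"
    then have "x \<in> steep_right (\<lambda>x. - g (- x)) q" using L steep_left_reflect[of "- x" g q] by auto
    then show "\<exists>\<^sub>F h in at_right 0. q * h \<le> - g (- (x + h)) - - g (- x)"
      by (auto simp: steep_right_def elim!: frequently_elim1)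
  qed (use assms in auto)
  moreover have "uminus -` C \<inter> {- b..- a} = uminus -` (C \<inter> {a..b})" by auto
  ultimately show ?thesis using measure_lborel_uminus[of "C \<inter> {a..b}"] \<open>closed C\<close> by simp
qed

lemma null_set_if_compact_subsets_null:
  fixes E :: "real set"
  assumes "E \<in> sets borel" and null: "\<And>C. compact C \<Longrightarrow> C \<subseteq> E \<Longrightarrow> measure lborel C = 0"
  shows "E \<in> null_sets lborel"
proof -
  have "emeasure lebesgue E \<le> ennreal e" if "e > 0" for e
  proof -
    obtain T where T: "closed T" "T \<subseteq> E" "emeasure lebesgue (E - T) < ennreal e"
    proof (rule sets_lebesgue_inner_closed[of E e])
      show "E \<in> sets lebesgue" using assms(1) by simp
    qed (use \<open>e > 0\<close> in blast)+
    have "T \<inter> {- real n..real n} \<in> null_sets lebesgue" for n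
    proof -
      have c: "compact (T \<inter> {- real n..real n})" using T by (intro closed_Int_compact) auto
      then have "measure lborel (T \<inter> {- real n..real n}) = 0" using T by (intro null) auto
      moreover have "emeasure lborel (T \<inter> {- real n..real n}) < \<infinity>"
        using emeasure_compact_finite[OF c] .
      ultimately have "emeasure lborel (T \<inter> {- real n..real n}) = 0"
        by (simp add: emeasure_eq_ennreal_measure)
      then have "T \<inter> {- real n..real n} \<in> null_sets lborel" using T by (simp add: null_sets_def)
      then show ?thesis by (rule null_sets_completionI)
    qed
    then have "(\<Union>n. T \<inter> {- real n..real n}) \<in> null_sets lebesgue" by (rule null_sets_UN)
    moreover have "(\<Union>n. T \<inter> {- real n..real n}) = T"
    proof (intro equalityI subsetI)
      fix x assume "x \<in> T"
      moreover obtain n where "\<bar>x\<bar> \<le> real n" using real_arch_simple by blast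
      ultimately show "x \<in> (\<Union>n. T \<inter> {- real n..real n})" by (auto simp: abs_le_iff intro!: exI[of _ n])
    qed auto
    ultimately have "T \<in> null_sets lebesgue" by simp
    then have "emeasure lebesgue (E - T) = emeasure lebesgue E"
      using assms(1) by (intro emeasure_Diff_null_set) simp_all
    with T show ?thesis by simp
  qed
  then have "emeasure lebesgue E \<le> 0" by - (rule ennreal_le_epsilon, simp)
  then have "emeasure lborel E = 0" using assms(1) by simp
  then show ?thesis using assms(1) by (simp add: null_sets_def)
qed

text \<open>
  On a compact part \<open>C\<close> of the set, \<open>g\<close> increases over \<open>[x, y]\<close> by at least \<open>q\<close> times the
  measure of \<open>C\<close> in \<open>[x, y]\<close>, and \<open>K * x - g x\<close> by at least \<open>K - p\<close> times that measure. The two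
  increments add up to \<open>K * (y - x)\<close>, so \<open>C\<close> fills at most the fraction \<open>K / (K + q - p) < 1\<close>
  of every interval. The bounds for the two increments hold for steepness on either side, so
  any upper Dini derivate is compared with any lower one.
\<close>

lemma null_steep_and_flat:
  fixes g :: "real \<Rightarrow> real"
  assumes g: "mono g" "continuous_on UNIV g" and g': "mono (\<lambda>x. K * x - g x)"
    and "p < q" "p \<le> K" "0 \<le> q"
    and "A = steep_right g q \<or> A = steep_left g q"
    and "B = steep_right (\<lambda>x. K * x - g x) (K - p) \<or> B = steep_left (\<lambda>x. K * x - g x) (K - p)"
  shows "A \<inter> B \<in> null_sets lborel"
proof (rule null_set_if_compact_subsets_null)
  have c': "continuous_on UNIV (\<lambda>x. K * x - g x)" by (intro continuous_intros g)
  show "A \<inter> B \<in> sets borel"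
    using assms borel_steep_right[OF g(2)] borel_steep_left[OF g(2)] borel_steep_right[OF c'] borel_steep_left[OF c'] by auto
  fix C assume C: "compact C" "C \<subseteq> A \<inter> B"
  have "0 \<le> K" using monoD[OF g(1), of 0 1] monoD[OF g', of 0 1] by simp
  show "measure lborel C = 0"
  proof (rule null_if_uniformly_sparse[OF C(1)])
    show "K / (K + q - p) < 1" using \<open>p < q\<close> \<open>0 \<le> K\<close> by (simp add: field_simps)
    fix x y :: real assume "x \<le> y"
    have "q * measure lborel (C \<inter> {x..y}) \<le> g y - g x"
      using C assms \<open>x \<le> y\<close> by (intro steep_mass_le_increment) (auto simp: compact_imp_closed)
    moreover have "(K - p) * measure lborel (C \<inter> {x..y}) \<le> (K * y - g y) - (K * x - g x)"
      using C assms c' \<open>x \<le> y\<close> by (intro steep_mass_le_increment) (auto simp: compact_imp_closed)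
    ultimately have "(K + q - p) * measure lborel (C \<inter> {x..y}) \<le> K * (y - x)"
      by (simp add: algebra_simps)
    then show "measure lborel (C \<inter> {x..y}) \<le> K / (K + q - p) * (y - x)"
      using \<open>p < q\<close> \<open>0 \<le> K\<close> by (simp add: field_simps)
  qed
qed

lemma tendsto_if_not_oscillating:
  fixes f :: "'a \<Rightarrow> real"
  assumes "F \<noteq> bot" and bnd: "\<forall>\<^sub>F x in F. a \<le> f x \<and> f x \<le> b"
    and osc: "\<And>p q. p \<in> \<rat> \<Longrightarrow> q \<in> \<rat> \<Longrightarrow> p < q \<Longrightarrow> \<not> ((\<exists>\<^sub>F x in F. f x < p) \<and> (\<exists>\<^sub>F x in F. q < f x))"
  shows "\<exists>l. (f \<longlongrightarrow> l) F"
proof -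
  define S where "S = {r. \<forall>\<^sub>F x in F. r \<le> f x}"
  have "a \<in> S" using bnd by (auto simp: S_def elim: eventually_mono)
  have ub: "r \<le> b" if "r \<in> S" for r
  proof -
    have "\<forall>\<^sub>F x in F. r \<le> b" using that bnd unfolding S_def by (auto elim: eventually_elim2)
    then show ?thesis using \<open>F \<noteq> bot\<close> by simp
  qed
  then have bdd: "bdd_above S" by (rule bdd_aboveI)
  have "(f \<longlongrightarrow> Sup S) F"
  proof (rule order_tendstoI)
    fix c assume "c < Sup S"
    then obtain r where "r \<in> S" "c < r" using less_cSup_iff[OF _ bdd] \<open>a \<in> S\<close> by blast
    then show "\<forall>\<^sub>F x in F. c < f x" by (auto simp: S_def elim: eventually_mono)
  next
    fix c assume "Sup S < c"
    \<comment> \<open>Values below \<open>p\<close> occur frequently since \<open>p\<close> exceeds \<open>Sup S\<close>; without oscillation, values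
      above \<open>q\<close> then cannot.\<close>
    then obtain q where q: "q \<in> \<rat>" "Sup S < q" "q < c" using Rats_dense_in_real by blast
    then obtain p where p: "p \<in> \<rat>" "Sup S < p" "p < q" using Rats_dense_in_real by blast
    have "p \<notin> S" using cSup_upper[OF _ bdd] p by fastforce
    then have "\<exists>\<^sub>F x in F. f x < p" by (simp add: S_def not_eventually not_le)
    with osc[OF p(1) q(1) p(3)] have "\<not> (\<exists>\<^sub>F x in F. q < f x)" by blast
    then have "\<forall>\<^sub>F x in F. f x \<le> q" by (simp add: not_frequently not_less)
    then show "\<forall>\<^sub>F x in F. f x < c" using q(3) by (auto elim: eventually_mono)
  qed
  then show ?thesis ..
qed

lemma frequently_at_0_cases:
  assumes "\<exists>\<^sub>F h in at (0::real). P h"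
  shows "(\<exists>\<^sub>F h in at_right 0. P h) \<or> (\<exists>\<^sub>F h in at_right 0. P (- h))"
  using assms by (auto simp: frequently_def eventually_at_split eventually_at_left_to_right)

text \<open>
  At a point where \<open>g\<close> is not differentiable the difference quotients oscillate across two
  rationals \<open>p < q\<close>, so one of the upper derivates is at least \<open>q\<close> and one of the lower ones
  at most \<open>p\<close>; for each of the countably many pairs this happens on a null set only.
\<close>

theorem AE_differentiable_mono_lipschitz:
  fixes g :: "real \<Rightarrow> real"
  assumes "mono g" "K-lipschitz_on UNIV g"
  shows "AE x in lebesgue. g differentiable (at x)"
proof -
  let ?g' = "\<lambda>x. K * x - g x"
  have lip: "g y - g x \<le> K * (y - x)" if "x \<le> y" for x y
    using lipschitz_onD[OF assms(2), of x y] that by (auto simp: dist_real_def abs_le_iff)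
  have cont: "continuous_on UNIV g" using assms(2) by (rule lipschitz_on_continuous_on)
  have mono': "mono ?g'" using lip by (auto simp: mono_def algebra_simps)
  define I where "I = {(p, q). p \<in> \<rat> \<and> q \<in> \<rat> \<and> p < q \<and> p \<le> K \<and> 0 \<le> q}"
  define N where "N = (\<Union>(p, q)\<in>I. (steep_right g q \<union> steep_left g q) \<inter>
      (steep_right ?g' (K - p) \<union> steep_left ?g' (K - p)))"
  have "countable I"
    by (rule countable_subset[of _ "\<rat> \<times> \<rat>"]) (auto simp: I_def countable_rat)
  moreover have "(steep_right g q \<union> steep_left g q) \<inter> (steep_right ?g' (K - p) \<union> steep_left ?g' (K - p))
      \<in> null_sets lborel" if "(p, q) \<in> I" for p q
  proof -
    have *: "A \<inter> B \<in> null_sets lborel" if "A \<in> {steep_right g q, steep_left g q}"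
      "B \<in> {steep_right ?g' (K - p), steep_left ?g' (K - p)}" for A B
      by (rule null_steep_and_flat[OF assms(1) cont mono', of p q])
        (use that \<open>(p, q) \<in> I\<close> in \<open>auto simp: I_def\<close>)
    show ?thesis by (simp add: Int_Un_distrib Int_Un_distrib2 null_sets.Un *)
  qed
  ultimately have N: "N \<in> null_sets lborel"
    unfolding N_def by - (rule null_sets_UN', auto)
  have "g differentiable (at x)" if "x \<notin> N" for x
  proof -
    let ?Q = "\<lambda>h. (g (x + h) - g x) / h"
    have Q: "0 \<le> ?Q h \<and> ?Q h \<le> K" if "h \<noteq> 0" for h
      using that monoD[OF assms(1), of x "x + h"] monoD[OF assms(1), of "x + h" x] lip[of x "x + h"] lip[of "x + h" x]
      by (cases "h > 0") (auto simp: field_simps)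
    have "\<exists>l. (?Q \<longlongrightarrow> l) (at 0)"
    proof (rule tendsto_if_not_oscillating)
      show "\<forall>\<^sub>F h in at 0. 0 \<le> ?Q h \<and> ?Q h \<le> K" using Q by (auto simp: eventually_at_filter)
      fix p q :: real
      assume pq: "p \<in> \<rat>" "q \<in> \<rat>" "p < q"
      show "\<not> ((\<exists>\<^sub>F h in at 0. ?Q h < p) \<and> (\<exists>\<^sub>F h in at 0. q < ?Q h))"
      proof
        assume *: "(\<exists>\<^sub>F h in at 0. ?Q h < p) \<and> (\<exists>\<^sub>F h in at 0. q < ?Q h)"
        have ev: "\<forall>\<^sub>F h in at (0::real). h \<noteq> 0" by (simp add: eventually_at_filter)
        have pos: "\<forall>\<^sub>F h in at_right (0::real). h > 0" by (rule eventually_at_right_less)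
        have "0 < p" "q < K"
        proof -
          obtain h where "h \<noteq> 0" "?Q h < p"
            using frequently_eventually_frequently[OF conjunct1[OF *] ev] by (auto dest: frequently_ex)
          with Q[of h] show "0 < p" by simp
          obtain h where "h \<noteq> 0" "?Q h > q"
            using frequently_eventually_frequently[OF conjunct2[OF *] ev] by (auto dest: frequently_ex)
          with Q[of h] show "q < K" by simp
        qed
        then have "(p, q) \<in> I" using pq by (auto simp: I_def)
        moreover have "x \<in> steep_right g q \<union> steep_left g q"
          using frequently_at_0_cases[OF conjunct2[OF *]]
        proof
          assume "\<exists>\<^sub>F h in at_right 0. q < ?Q h"
          from frequently_eventually_frequently[OF this pos]
          have "\<exists>\<^sub>F h in at_right 0. q * h < g (x + h) - g x"
            by (rule frequently_elim1) (auto simp: field_simps)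
          then show ?thesis by (simp add: steep_right_def)
        next
          assume "\<exists>\<^sub>F h in at_right 0. q < ?Q (- h)"
          from frequently_eventually_frequently[OF this pos]
          have "\<exists>\<^sub>F h in at_right 0. q * h < g x - g (x - h)"
            by (rule frequently_elim1) (auto simp: field_simps)
          then show ?thesis by (simp add: steep_left_def)
        qed
        moreover have "x \<in> steep_right ?g' (K - p) \<union> steep_left ?g' (K - p)"
          using frequently_at_0_cases[OF conjunct1[OF *]]
        proof
          assume "\<exists>\<^sub>F h in at_right 0. ?Q h < p"
          from frequently_eventually_frequently[OF this pos]
          have "\<exists>\<^sub>F h in at_right 0. (K - p) * h < ?g' (x + h) - ?g' x"
            by (rule frequently_elim1) (auto simp: field_simps)
          then show ?thesis by (simp add: steep_right_def)
        next
          assume "\<exists>\<^sub>F h in at_right 0. ?Q (- h) < p"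
          from frequently_eventually_frequently[OF this pos]
          have "\<exists>\<^sub>F h in at_right 0. (K - p) * h < ?g' x - ?g' (x - h)"
            by (rule frequently_elim1) (auto simp: field_simps)
          then show ?thesis by (simp add: steep_left_def)
        qed
        ultimately have "x \<in> N" unfolding N_def by blast
        with \<open>x \<notin> N\<close> show False ..
      qed
    qed simp
    then show ?thesis by (simp add: real_differentiable_def DERIV_def)
  qed
  then have "AE x in lborel. g differentiable (at x)"
    using AE_not_in[OF N] by (auto elim: eventually_mono)
  then show ?thesis by (rule AE_completion)
qed

section \<open>Integrating almost everywhere derivatives\<close>

text \<open>
  If \<open>P\<close> is an antiderivative of \<open>f\<close>, then the difference quotient \<open>(P (x + h) - P x) / h\<close> is
  an antiderivative of the difference quotient of \<open>f\<close>. The latter is bounded by the Lipschitz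
  constant, so dominated convergence lets \<open>h\<close> tend to \<open>0\<close> under the integral. The unit margin
  around \<open>[a, b]\<close> makes room for the shift by \<open>h\<close>.
\<close>

lemma has_integral_AE_derivative_lipschitz:
  fixes f f' :: "real \<Rightarrow> real"
  assumes "a \<le> b" and lip: "K-lipschitz_on {a - 1..b + 1} f" and "negligible N"
    and deriv: "\<And>x. x \<in> {a..b} - N \<Longrightarrow> (f has_real_derivative f' x) (at x)"
  shows "(f' has_integral f b - f a) {a..b}"
proof -
  obtain P where P: "\<And>x. x \<in> {a - 1..b + 1} \<Longrightarrow> (P has_vector_derivative f x) (at x within {a - 1..b + 1})"
    using antiderivative_continuous[OF lipschitz_on_continuous_on[OF lip]] by metis
  have P': "(P has_real_derivative f x) (at x)" if "x \<in> {a - 1<..<b + 1}" for x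
    using P[of x] that at_within_Icc_at[of "a - 1" x "b + 1"]
    by (auto simp: has_real_derivative_iff_has_vector_derivative)
  \<comment> \<open>Steps below \<open>1\<close> keep \<open>x + h k\<close> strictly inside the interval on which \<open>P' = f\<close>.\<close>
  define h :: "nat \<Rightarrow> real" where "h k = 1 / (real k + 2)" for k
  have h: "0 < h k" "h k < 1" for k by (auto simp: h_def)
  have "h \<longlonglongrightarrow> 0" unfolding h_def by real_asymp
  then have h0: "filterlim h (at 0) sequentially"
    by (simp add: filterlim_at h(1)[THEN less_imp_neq, symmetric])
  have lim: "(\<lambda>k. (F (x + h k) - F x) / h k) \<longlonglongrightarrow> D" if "(F has_real_derivative D) (at x)" for F x D
    using filterlim_compose[OF that[unfolded DERIV_def] h0] .
  let ?Q = "\<lambda>k x. (f (x + h k) - f x) / h k"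
  have "((\<lambda>x. if x \<in> N then 0 else f' x) has_integral f b - f a) {a..b}"
  proof (rule has_integral_dominated_convergence)
    fix k
    have "((?Q k) has_integral (P (b + h k) - P b) / h k - (P (a + h k) - P a) / h k) {a..b}"
    proof (rule fundamental_theorem_of_calculus[OF \<open>a \<le> b\<close>])
      fix x assume x: "x \<in> {a..b}"
      have "((\<lambda>x. P (x + h k)) has_real_derivative f (x + h k)) (at x)"
        using P'[of "x + h k"] x h[of k] by (subst DERIV_shift[symmetric]) auto
      then have "((\<lambda>x. (P (x + h k) - P x) / h k) has_real_derivative ?Q k x) (at x)"
        using P'[of x] x by (intro DERIV_cdivide DERIV_diff) auto
      then show "((\<lambda>x. (P (x + h k) - P x) / h k) has_vector_derivative ?Q k x) (at x within {a..b})"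
        by (simp add: has_real_derivative_iff_has_vector_derivative has_vector_derivative_at_within)
    qed
    then show "((\<lambda>x. if x \<in> N then 0 else ?Q k x) has_integral (P (b + h k) - P b) / h k - (P (a + h k) - P a) / h k) {a..b}"
      by (rule has_integral_spike[OF \<open>negligible N\<close>, rotated]) auto
    have "\<bar>?Q k x\<bar> \<le> K" if "x \<in> {a..b}" for x
      using lipschitz_onD[OF lip, of "x + h k" x] that h[of k] by (auto simp: dist_real_def abs_divide field_simps)
    then show "\<forall>x\<in>{a..b}. norm (if x \<in> N then 0 else ?Q k x) \<le> K"
      using lipschitz_on_nonneg[OF lip] by auto
  next
    show "\<forall>x\<in>{a..b}. (\<lambda>k. if x \<in> N then 0 else ?Q k x) \<longlonglongrightarrow> (if x \<in> N then 0 else f' x)"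
      using lim[OF deriv] by auto
    show "(\<lambda>k. (P (b + h k) - P b) / h k - (P (a + h k) - P a) / h k) \<longlonglongrightarrow> f b - f a"
      using \<open>a \<le> b\<close> by (intro tendsto_diff lim P') auto
  qed auto
  then show ?thesis
    by (rule has_integral_spike[OF \<open>negligible N\<close>, rotated]) auto
qed

lemma has_integral_exhaustion:
  fixes f :: "real \<Rightarrow> real"
  assumes "\<And>k. (f has_integral I k) (S k)" "\<And>k. S k \<subseteq> S (Suc k)" "(\<Union>k. S k) = T"
    and nonneg: "\<And>x. x \<in> T \<Longrightarrow> 0 \<le> f x" and "I \<longlonglongrightarrow> L"
  shows "(f has_integral L) T"
proof (rule has_integral_monotone_convergence_increasing[where f = "\<lambda>k x. if x \<in> S k then f x else 0", OF _ _ _ \<open>I \<longlonglongrightarrow> L\<close>])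
  fix k
  have "S k \<subseteq> T" using assms(3) by auto
  then show "((\<lambda>x. if x \<in> S k then f x else 0) has_integral I k) T"
    using assms(1) by (simp add: has_integral_restrict)
  fix x assume "x \<in> T"
  then show "(if x \<in> S k then f x else 0) \<le> (if x \<in> S (Suc k) then f x else 0)"
    using assms(2)[of k] nonneg by auto
  obtain k0 where "x \<in> S k0" using \<open>x \<in> T\<close> assms(3) by auto
  then have "x \<in> S k" if "k \<ge> k0" for k using lift_Suc_mono_le[of S, OF assms(2) that] by auto
  then show "(\<lambda>k. if x \<in> S k then f x else 0) \<longlonglongrightarrow> f x"
    by (intro tendsto_eventually eventually_sequentiallyI[of k0]) auto
qed

lemma lebesgue_integral_of_nonneg_has_integral:
  fixes f :: "real \<Rightarrow> real"
  assumes "(f has_integral I) S" "\<And>x. x \<in> S \<Longrightarrow> 0 \<le> f x" "negligible N" "\<And>x. x \<in> S - N \<Longrightarrow> g x = f x"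
  shows "set_integrable lebesgue S g" "(LINT x:S|lebesgue. g x) = I"
proof -
  have "f absolutely_integrable_on S"
    using assms(1,2) by (intro nonnegative_absolutely_integrable_1) auto
  then show *: "set_integrable lebesgue S g"
    by (rule absolutely_integrable_spike[OF _ \<open>negligible N\<close> assms(4)])
  have "(g has_integral I) S"
    using has_integral_spike[OF \<open>negligible N\<close> _ assms(1)] assms(4) by auto
  then show "(LINT x:S|lebesgue. g x) = I"
    using set_lebesgue_integral_eq_integral(2)[OF *] by (simp add: integral_unique)
qed

section \<open>Conjugates of strongly convex functions\<close>

text \<open>
  The subgradient inequalities at \<open>x\<close> and at \<open>x + h\<close> enclose the difference quotient of \<open>m\<close>
  between \<open>t x\<close> and \<open>t (x + h)\<close>.
\<close>

lemma has_real_derivative_continuous_subgradient: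
  fixes m t :: "real \<Rightarrow> real"
  assumes sub: "\<And>x y. m x + t x * (y - x) \<le> m y" and "isCont t x"
  shows "(m has_real_derivative t x) (at x)"
  unfolding DERIV_def
proof (rule tendsto_sandwich)
  have "(\<lambda>h. t (x + h)) \<midarrow>0\<rightarrow> t x"
    using assms(2) by (simp add: isCont_iff)
  then show "(\<lambda>h. min (t x) (t (x + h))) \<midarrow>0\<rightarrow> t x" "(\<lambda>h. max (t x) (t (x + h))) \<midarrow>0\<rightarrow> t x"
    using tendsto_min[OF tendsto_const[of "t x"], of _ "t x"] tendsto_max[OF tendsto_const[of "t x"], of _ "t x"] by auto
  have *: "min (t x) (t (x + h)) \<le> (m (x + h) - m x) / h \<and> (m (x + h) - m x) / h \<le> max (t x) (t (x + h))" if "h \<noteq> 0" for h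
  proof (cases "h > 0")
    case True
    then have "t x \<le> (m (x + h) - m x) / h" "(m (x + h) - m x) / h \<le> t (x + h)"
      using sub[of x "x + h"] sub[of "x + h" x] by (auto simp: field_simps)
    then show ?thesis by auto
  next
    case False
    then have "t (x + h) \<le> (m (x + h) - m x) / h" "(m (x + h) - m x) / h \<le> t x"
      using that sub[of x "x + h"] sub[of "x + h" x] by (auto simp: field_simps)
    then show ?thesis by auto
  qed
  show "\<forall>\<^sub>F h in at 0. min (t x) (t (x + h)) \<le> (m (x + h) - m x) / h"
    "\<forall>\<^sub>F h in at 0. (m (x + h) - m x) / h \<le> max (t x) (t (x + h))"
    using * by (auto simp: eventually_at_filter)
qed

lemma strongly_convex_scaled_dual:
  assumes "strongly_convex_on {0..1} d" "0 < real n * (1 - p)" "1 / (real n * (1 - p)) \<le> 1"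
  shows "strongly_convex_on {0..1} (scaled_dual n p d)"
proof -
  define c where "c = real n * (1 - p)"
  have c: "0 < c" "1 / c \<le> 1" using assms by (auto simp: c_def)
  obtain \<mu> where \<mu>: "\<mu> > 0" and sc: "\<And>x y u. x \<in> {0..1} \<Longrightarrow> y \<in> {0..1} \<Longrightarrow> u \<in> {0..1} \<Longrightarrow>
      d (u * x + (1 - u) * y) \<le> u * d x + (1 - u) * d y - \<mu> / 2 * u * (1 - u) * (x - y)\<^sup>2"
    using assms(1) unfolding strongly_convex_on_def by blast
  have "scaled_dual n p d (u * x + (1 - u) * y)
     \<le> u * scaled_dual n p d x + (1 - u) * scaled_dual n p d y - (\<mu> / c) / 2 * u * (1 - u) * (x - y)\<^sup>2"
    if "x \<in> {0..1}" "y \<in> {0..1}" "u \<in> {0..1}" for x y u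
  proof -
    have "x / c \<in> {0..1}" "y / c \<in> {0..1}" using that c by (auto simp: field_simps)
    from mult_left_mono[OF sc[OF this that(3)], of c] c
    have "c * d (u * (x / c) + (1 - u) * (y / c))
      \<le> c * (u * d (x / c) + (1 - u) * d (y / c) - \<mu> / 2 * u * (1 - u) * (x / c - y / c)\<^sup>2)" by simp
    also have "u * (x / c) + (1 - u) * (y / c) = (u * x + (1 - u) * y) / c"
      by (simp add: add_divide_distrib)
    also have "c * (u * d (x / c) + (1 - u) * d (y / c) - \<mu> / 2 * u * (1 - u) * (x / c - y / c)\<^sup>2)
      = u * (c * d (x / c)) + (1 - u) * (c * d (y / c)) - (\<mu> / c) / 2 * u * (1 - u) * (x - y)\<^sup>2"
    proof -
      have "c * (\<mu> / 2 * u * (1 - u) * (x / c - y / c)\<^sup>2) = (\<mu> / c) / 2 * u * (1 - u) * (x - y)\<^sup>2"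
        using c by (simp add: diff_divide_distrib[symmetric] power_divide power2_eq_square[of c])
      then show ?thesis by (simp add: right_diff_distrib distrib_left mult.left_commute)
    qed
    finally show ?thesis by (simp add: scaled_dual_def c_def)
  qed
  then show ?thesis using \<mu> c unfolding strongly_convex_on_def by (auto intro!: exI[of _ "\<mu> / c"])
qed

text \<open>
  By strong convexity the objective falls at least quadratically away from its maximiser.
  Adding this estimate for two parameters, each tested at the maximiser of the other, gives
  \<open>\<mu> * (t y - t x)\<^sup>2 \<le> (y - x) * (t y - t x)\<close>, which contains both monotonicity and the
  Lipschitz bound \<open>1 / \<mu>\<close>.
\<close>

lemma strongly_convex_conjugate_maximizer:
  assumes "strongly_convex_on {0..1} f"
    and max: "\<And>\<eta>. is_maximum (\<lambda>t. \<eta> * t - f t) {0..1} (m \<eta>)"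
  obtains t K where "\<And>\<eta>. t \<eta> \<in> {0..1}" "\<And>\<eta>. \<eta> * t \<eta> - f (t \<eta>) = m \<eta>" "mono t" "K-lipschitz_on UNIV t"
proof -
  obtain \<mu> where \<mu>: "\<mu> > 0" and sc: "\<And>x y u. x \<in> {0..1} \<Longrightarrow> y \<in> {0..1} \<Longrightarrow> u \<in> {0..1} \<Longrightarrow>
      f (u * x + (1 - u) * y) \<le> u * f x + (1 - u) * f y - \<mu> / 2 * u * (1 - u) * (x - y)\<^sup>2"
    using assms(1) unfolding strongly_convex_on_def by blast
  obtain t where t: "\<And>\<eta>. t \<eta> \<in> {0..1}" and tm: "\<And>\<eta>. \<eta> * t \<eta> - f (t \<eta>) = m \<eta>"
    using max unfolding is_maximum_def by metis
  have le: "\<eta> * s - f s \<le> m \<eta>" if "s \<in> {0..1}" for \<eta> s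
    using max that unfolding is_maximum_def by blast
  have growth: "\<eta> * s - f s \<le> m \<eta> - \<mu> / 2 * (s - t \<eta>)\<^sup>2" if s: "s \<in> {0..1}" for \<eta> s
  proof (rule ccontr)
    define A where "A = \<eta> * s - f s - m \<eta>"
    define B where "B = \<mu> / 2 * (s - t \<eta>)\<^sup>2"
    assume "\<not> ?thesis"
    then have AB: "A + B > 0" by (simp add: A_def B_def)
    have "A \<le> 0" using le[OF s, of \<eta>] by (simp add: A_def)
    then have B: "B > 0" using AB by simp
    \<comment> \<open>Convexity on the segment from the maximiser to \<open>s\<close>, at weight \<open>u\<close>, yields
      \<open>A + (1 - u) * B \<le> 0\<close>; this \<open>u\<close> is small enough for a contradiction to \<open>A + B > 0\<close>.\<close>
    define u where "u = min (1/2) ((A + B) / (2 * B))"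
    have u: "0 < u" "u < 1" using AB B by (auto simp: u_def)
    have "u * B \<le> (A + B) / (2 * B) * B" using B by (intro mult_right_mono) (auto simp: u_def)
    then have "A + B - u * B > 0" using B AB by simp
    let ?z = "u * s + (1 - u) * t \<eta>"
    have z: "?z \<in> {0..1}" using convexD[OF convex_real_interval(5) s t[of \<eta>], of u "1 - u"] u by simp
    have "m \<eta> \<ge> \<eta> * ?z - f ?z" by (rule le[OF z])
    moreover have "f ?z \<le> u * f s + (1 - u) * f (t \<eta>) - u * ((1 - u) * B)"
      using sc[OF s t[of \<eta>], of u] u by (simp add: B_def mult.assoc mult.left_commute)
    moreover have "\<eta> * ?z - (u * f s + (1 - u) * f (t \<eta>) - u * ((1 - u) * B)) = m \<eta> + u * (A + B - u * B)"
      unfolding tm[of \<eta>, symmetric] A_def by algebra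
    ultimately have "u * (A + B - u * B) \<le> 0" by linarith
    with u \<open>A + B - u * B > 0\<close> show False by (simp add: mult_le_0_iff)
  qed
  have key: "\<mu> * (t y - t x)\<^sup>2 \<le> (y - x) * (t y - t x)" for x y
  proof -
    have "x * t y - f (t y) \<le> m x - \<mu> / 2 * (t y - t x)\<^sup>2" "y * t x - f (t x) \<le> m y - \<mu> / 2 * (t y - t x)\<^sup>2"
      using growth[OF t, of x y] growth[OF t, of y x] by (auto simp: power2_commute)
    with tm[of x] tm[of y] show ?thesis by (simp add: algebra_simps)
  qed
  have "mono t"
  proof (rule monoI, rule ccontr)
    fix x y :: real assume "x \<le> y" "\<not> t x \<le> t y"
    then have "(y - x) * (t y - t x) \<le> 0" "0 < \<mu> * (t y - t x)\<^sup>2"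
      using \<mu> by (auto simp: mult_le_0_iff)
    with key[of y x] show False by simp
  qed
  moreover have "(1 / \<mu>)-lipschitz_on UNIV t"
  proof (rule lipschitz_onI)
    fix x y :: real
    have "\<mu> * \<bar>t x - t y\<bar> * \<bar>t x - t y\<bar> \<le> \<bar>x - y\<bar> * \<bar>t x - t y\<bar>"
      using order_trans[OF key[of x y] abs_ge_self] by (simp add: abs_mult power2_eq_square mult.assoc)
    then have "\<mu> * \<bar>t x - t y\<bar> \<le> \<bar>x - y\<bar>"
      by (cases "t x = t y") (auto dest: mult_right_le_imp_le)
    then show "dist (t x) (t y) \<le> 1 / \<mu> * dist x y" using \<mu> by (simp add: dist_real_def field_simps)
  qed (use \<mu> in auto)
  ultimately show thesis using that t tm by blast
qed

text \<open>
  The limits of the slope \<open>t\<close> come from comparing the maximiser with the end points \<open>0\<close> and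
  \<open>1\<close>. The limit of \<open>m\<close> need not be \<open>- f 0\<close>, since \<open>f\<close> may jump at \<open>0\<close>; it exists because
  \<open>m\<close> is increasing and bounded below. The boundary term \<open>k * t (\<eta> - k)\<close> of the integration by
  parts vanishes as \<open>k\<close> tends to infinity: by convexity it is at most twice the increment of
  \<open>m\<close> over \<open>[\<eta> - k, \<eta> - k / 2]\<close>.
\<close>

theorem strongly_convex_conjugate_is_convolution:
  fixes f m :: "real \<Rightarrow> real"
  assumes "strongly_convex_on {0..1} f"
    and max: "\<And>\<eta>. is_maximum (\<lambda>t. \<eta> * t - f t) {0..1} (m \<eta>)"
  shows "m differentiable (at s)"
    and "AE s in lebesgue. deriv m differentiable (at s)"
    and "\<exists>L. (m \<longlongrightarrow> L) at_bot \<and>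
          (\<forall>\<rho> :: real \<Rightarrow> real.
             (AE s in lebesgue. (deriv m has_real_derivative \<rho> s) (at s)) \<longrightarrow>
               (AE s in lebesgue. 0 \<le> \<rho> s) \<and> has_bochner_integral lebesgue \<rho> 1 \<and>
               (\<forall>\<eta>. set_integrable lebesgue {..\<eta>} (\<lambda>s. (\<eta> - s) * \<rho> s) \<and>
                    m \<eta> = L + (LINT s:{..\<eta>}|lebesgue. (\<eta> - s) * \<rho> s)))"
proof -
  obtain t K where t: "\<And>\<eta>. t \<eta> \<in> {0..1}" and tm: "\<And>\<eta>. \<eta> * t \<eta> - f (t \<eta>) = m \<eta>"
    and "mono t" and lip: "K-lipschitz_on UNIV t"
    using strongly_convex_conjugate_maximizer[OF assms] by metis
  have le: "\<eta> * s - f s \<le> m \<eta>" if "s \<in> {0..1}" for \<eta> s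
    using max that unfolding is_maximum_def by blast
  have sub: "m x + t x * (y - x) \<le> m y" for x y
    using le[OF t[of x], of y] tm[of x] by (simp add: algebra_simps)
  have "isCont t x" for x
    using lipschitz_on_continuous_on[OF lip] by (simp add: continuous_on_eq_continuous_at)
  then have dm: "(m has_real_derivative t x) (at x)" for x
    using has_real_derivative_continuous_subgradient[OF sub] by blast
  then show "m differentiable (at s)" using real_differentiable_def by blast
  have [simp]: "deriv m = t" using DERIV_imp_deriv[OF dm] by blast
  show "AE s in lebesgue. deriv m differentiable (at s)"
    using AE_differentiable_mono_lipschitz[OF \<open>mono t\<close> lip] by simp
  have m_lip: "\<bar>m x - m y\<bar> \<le> \<bar>x - y\<bar>" for x y
  proof -
    have "\<bar>t z * (x - y)\<bar> \<le> \<bar>x - y\<bar>" for z using t[of z] by (simp add: abs_mult mult_left_le_one_le)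
    from this[of x] this[of y] sub[of x y] sub[of y x] show ?thesis by (simp add: abs_le_iff algebra_simps)
  qed
  have "mono m"
  proof (rule monoI)
    fix x y :: real assume "x \<le> y"
    then have "0 \<le> t x * (y - x)" using t[of x] by simp
    with sub[of x y] show "m x \<le> m y" by simp
  qed
  have bdd: "bdd_below (range m)"
  proof (rule bdd_belowI2)
    fix x show "- f 0 \<le> m x" using le[of 0 x] by simp
  qed
  define L where "L = Inf (range m)"
  have mL: "(m \<longlongrightarrow> L) at_bot"
  proof (rule order_tendstoI)
    fix c assume "c < L"
    then show "\<forall>\<^sub>F x in at_bot. c < m x"
      unfolding L_def by (intro always_eventually allI) (meson bdd cInf_lower less_le_trans rangeI)
  next
    fix c assume "L < c"
    then obtain y where "m y < c" unfolding L_def using cInf_less_iff[OF _ bdd] by auto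
    then show "\<forall>\<^sub>F x in at_bot. m x < c"
      using monoD[OF \<open>mono m\<close>] by (intro eventually_at_bot_linorderI[of y]) (meson le_less_trans)
  qed
  have t_bot: "(t \<longlongrightarrow> 0) at_bot"
  proof (rule tendsto_sandwich[where f = "\<lambda>_. 0"])
    show "\<forall>\<^sub>F x in at_bot. t x \<le> (f 0 + m 0) / (- x)"
      using eventually_gt_at_bot[of 0]
    proof eventually_elim
      case (elim x)
      have "x * t x \<ge> - (f 0 + m 0)" using le[of 0 x] le[OF t[of x], of 0] tm[of x] by simp
      then show ?case using elim by (simp add: field_simps)
    qed
    show "((\<lambda>x. (f 0 + m 0) / (- x)) \<longlongrightarrow> 0) at_bot" by real_asymp
  qed (use t in auto)
  have t_top: "(t \<longlongrightarrow> 1) at_top"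
  proof (rule tendsto_sandwich[where h = "\<lambda>_. 1"])
    show "\<forall>\<^sub>F x in at_top. 1 - (f 1 + m 0) / x \<le> t x"
      using eventually_gt_at_top[of 0]
    proof eventually_elim
      case (elim x)
      have "x - f 1 \<le> x * t x + m 0" using le[of 1 x] le[OF t[of x], of 0] tm[of x] by simp
      then show ?case using elim by (simp add: field_simps)
    qed
    show "((\<lambda>x. 1 - (f 1 + m 0) / x) \<longlongrightarrow> 1) at_top" by real_asymp
  qed (use t in auto)
  show "\<exists>L. (m \<longlongrightarrow> L) at_bot \<and>
          (\<forall>\<rho> :: real \<Rightarrow> real.
             (AE s in lebesgue. (deriv m has_real_derivative \<rho> s) (at s)) \<longrightarrow>
               (AE s in lebesgue. 0 \<le> \<rho> s) \<and> has_bochner_integral lebesgue \<rho> 1 \<and>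
               (\<forall>\<eta>. set_integrable lebesgue {..\<eta>} (\<lambda>s. (\<eta> - s) * \<rho> s) \<and>
                    m \<eta> = L + (LINT s:{..\<eta>}|lebesgue. (\<eta> - s) * \<rho> s)))"
  proof (intro exI[of _ L] conjI mL allI impI)
    fix \<rho> :: "real \<Rightarrow> real" assume "AE s in lebesgue. (deriv m has_real_derivative \<rho> s) (at s)"
    then obtain N where "N \<in> null_sets lebesgue" and d: "\<And>s. s \<notin> N \<Longrightarrow> (t has_real_derivative \<rho> s) (at s)"
      by (auto elim: AE_E3)
    then have N: "negligible N" by (simp add: negligible_iff_null_sets)
    have \<rho>0: "0 \<le> \<rho> s" if "s \<notin> N" for s
    proof (rule tendsto_lowerbound[OF d[OF that, unfolded DERIV_def]])
      show "\<forall>\<^sub>F h in at 0. 0 \<le> (t (s + h) - t s) / h"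
      proof (rule always_eventually, rule allI)
        fix h show "0 \<le> (t (s + h) - t s) / h"
          using monoD[OF \<open>mono t\<close>, of s "s + h"] monoD[OF \<open>mono t\<close>, of "s + h" s]
          by (cases "h \<ge> 0") (auto simp: divide_nonpos_nonpos)
      qed
    qed auto
    then show "AE s in lebesgue. 0 \<le> \<rho> s"
      using AE_not_in[OF \<open>N \<in> null_sets lebesgue\<close>] by (auto elim: eventually_mono)
    \<comment> \<open>A version of \<open>\<rho>\<close> that is nonnegative everywhere, as monotone exhaustion requires.\<close>
    define \<rho>' where "\<rho>' s = (if s \<in> N then 0 else \<rho> s)" for s
    have \<rho>': "0 \<le> \<rho>' s" for s using \<rho>0 by (simp add: \<rho>'_def)
    have d': "(t has_real_derivative \<rho>' s) (at s)" if "s \<notin> N" for s using d[OF that] that by (simp add: \<rho>'_def)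
    have "(\<rho>' has_integral 1) UNIV"
    proof (rule has_integral_exhaustion)
      fix k :: nat
      show "(\<rho>' has_integral t (real k) - t (- real k)) {- real k..real k}"
        using d' lipschitz_on_subset[OF lip]
        by (intro has_integral_AE_derivative_lipschitz[OF _ _ N]) auto
      show "{- real k..real k} \<subseteq> {- real (Suc k)..real (Suc k)}" by auto
    next
      show "(\<Union>k. {- real k..real k}) = UNIV"
      proof (intro equalityI subsetI)
        fix x :: real
        obtain n where "\<bar>x\<bar> \<le> real n" using real_arch_simple by blast
        then show "x \<in> (\<Union>k. {- real k..real k})" by (auto simp: abs_le_iff intro!: exI[of _ n])
      qed auto
      have "(\<lambda>k. t (real k) - t (- real k)) \<longlonglongrightarrow> 1 - 0"
        by (intro tendsto_diff filterlim_compose[OF t_top] filterlim_compose[OF t_bot]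
            filterlim_real_sequentially filterlim_compose[OF filterlim_uminus_at_bot_at_top])
      then show "(\<lambda>k. t (real k) - t (- real k)) \<longlonglongrightarrow> 1" by simp
    qed (use \<rho>' in auto)
    from lebesgue_integral_of_nonneg_has_integral[OF this \<rho>' N, of \<rho>]
    show "has_bochner_integral lebesgue \<rho> 1"
      by (auto simp: \<rho>'_def set_integrable_def set_lebesgue_integral_def has_bochner_integral_iff)
    fix \<eta> :: real
    have "((\<lambda>s. (\<eta> - s) * \<rho>' s) has_integral m \<eta> - L) {..\<eta>}"
    proof (rule has_integral_exhaustion)
      let ?\<Phi> = "\<lambda>s. (\<eta> - s) * t s + m s"
      fix k :: nat
      have lip': "(\<bar>K\<bar> * (real k + 1) + 2)-lipschitz_on {\<eta> - real k - 1..\<eta> + 1} ?\<Phi>"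
      proof (rule lipschitz_onI)
        fix x y assume xy: "x \<in> {\<eta> - real k - 1..\<eta> + 1}" "y \<in> {\<eta> - real k - 1..\<eta> + 1}"
        have "\<bar>(\<eta> - x) * (t x - t y)\<bar> \<le> (real k + 1) * (\<bar>K\<bar> * \<bar>x - y\<bar>)"
          unfolding abs_mult using xy lipschitz_onD[OF lip, of x y] lipschitz_on_nonneg[OF lip]
          by (intro mult_mono) (auto simp: dist_real_def)
        moreover have "\<bar>t y * (x - y)\<bar> \<le> \<bar>x - y\<bar>" using t[of y] by (simp add: abs_mult mult_left_le_one_le)
        moreover have "?\<Phi> x - ?\<Phi> y = (\<eta> - x) * (t x - t y) - t y * (x - y) + (m x - m y)"
          by (simp add: algebra_simps)
        ultimately have "\<bar>?\<Phi> x - ?\<Phi> y\<bar> \<le> (real k + 1) * (\<bar>K\<bar> * \<bar>x - y\<bar>) + 2 * \<bar>x - y\<bar>"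
        proof -
          have tri: "\<bar>a - b + c\<bar> \<le> A + 2 * B" if "\<bar>a\<bar> \<le> A" "\<bar>b\<bar> \<le> B" "\<bar>c\<bar> \<le> B" for a b c A B :: real
            using that by linarith
          show ?thesis
            unfolding \<open>?\<Phi> x - ?\<Phi> y = _\<close> by (intro tri m_lip) fact+
        qed
        then show "dist (?\<Phi> x) (?\<Phi> y) \<le> (\<bar>K\<bar> * (real k + 1) + 2) * dist x y"
          by (simp add: dist_real_def algebra_simps)
      qed simp
      have "(?\<Phi> has_real_derivative (\<eta> - s) * \<rho>' s) (at s)" if "s \<notin> N" for s
        by (rule derivative_eq_intros d'[OF that] dm refl)+ simp
      then have "((\<lambda>s. (\<eta> - s) * \<rho>' s) has_integral ?\<Phi> \<eta> - ?\<Phi> (\<eta> - real k)) {\<eta> - real k..\<eta>}"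
        by (intro has_integral_AE_derivative_lipschitz[OF _ lip' N]) auto
      then show "((\<lambda>s. (\<eta> - s) * \<rho>' s) has_integral m \<eta> - (real k * t (\<eta> - real k) + m (\<eta> - real k))) {\<eta> - real k..\<eta>}"
        by simp
    next
      have bot: "filterlim (\<lambda>k. \<eta> - real k) at_bot sequentially"
        "filterlim (\<lambda>k. \<eta> - real k / 2) at_bot sequentially" by real_asymp+
      have m1: "(\<lambda>k. m (\<eta> - real k)) \<longlonglongrightarrow> L" and m2: "(\<lambda>k. m (\<eta> - real k / 2)) \<longlonglongrightarrow> L"
        using bot by (auto intro: filterlim_compose[OF mL])
      have "(\<lambda>k. real k * t (\<eta> - real k)) \<longlonglongrightarrow> 0"
      proof (rule tendsto_sandwich[where f = "\<lambda>_. 0"])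
        have "(\<lambda>k. 2 * (m (\<eta> - real k / 2) - m (\<eta> - real k))) \<longlonglongrightarrow> 2 * (L - L)"
          by (intro tendsto_intros m1 m2)
        then show "(\<lambda>k. 2 * (m (\<eta> - real k / 2) - m (\<eta> - real k))) \<longlonglongrightarrow> 0" by simp
        have "real k * t (\<eta> - real k) \<le> 2 * (m (\<eta> - real k / 2) - m (\<eta> - real k))" for k
          using sub[of "\<eta> - real k" "\<eta> - real k / 2"] by (simp add: algebra_simps)
        then show "\<forall>\<^sub>F k in sequentially. real k * t (\<eta> - real k) \<le> 2 * (m (\<eta> - real k / 2) - m (\<eta> - real k))"
          by simp
      qed (use t in auto)
      then have "(\<lambda>k. m \<eta> - (real k * t (\<eta> - real k) + m (\<eta> - real k))) \<longlonglongrightarrow> m \<eta> - (0 + L)"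
        by (intro tendsto_intros m1)
      then show "(\<lambda>k. m \<eta> - (real k * t (\<eta> - real k) + m (\<eta> - real k))) \<longlonglongrightarrow> m \<eta> - L" by simp
      show "(\<Union>k. {\<eta> - real k..\<eta>}) = {..\<eta>}"
      proof (intro equalityI subsetI)
        fix x assume "x \<in> {..\<eta>}"
        moreover obtain n where "\<eta> - x \<le> real n" using real_arch_simple by blast
        ultimately show "x \<in> (\<Union>k. {\<eta> - real k..\<eta>})" by (auto intro!: exI[of _ n])
      qed auto
    qed (use \<rho>' in auto)
    note * = lebesgue_integral_of_nonneg_has_integral[OF this _ N, of "\<lambda>s. (\<eta> - s) * \<rho> s"]
    show "set_integrable lebesgue {..\<eta>} (\<lambda>s. (\<eta> - s) * \<rho> s)"
      by (rule *(1)) (use \<rho>' in \<open>auto simp: \<rho>'_def\<close>)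
    have "(LINT s:{..\<eta>}|lebesgue. (\<eta> - s) * \<rho> s) = m \<eta> - L"
      by (rule *(2)) (use \<rho>' in \<open>auto simp: \<rho>'_def\<close>)
    then show "m \<eta> = L + (LINT s:{..\<eta>}|lebesgue. (\<eta> - s) * \<rho> s)" by simp
  qed
qed

section \<open>Smoothing by a density with finite first moment\<close>

locale first_moment_density =
  fixes \<rho> :: "real \<Rightarrow> real"
  assumes nonneg: "0 \<le> \<rho> s"
    and total: "has_bochner_integral lborel \<rho> 1"
    and moment: "integrable lborel (\<lambda>s. \<bar>s\<bar> * \<rho> s)"
begin

abbreviation "law \<equiv> density lborel (\<lambda>s. ennreal (\<rho> s))"

definition mean :: real where "mean = (LINT s|lborel. s * \<rho> s)"

lemma integrable_density: "integrable lborel \<rho>"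
  using total by (simp add: has_bochner_integral_iff)

lemma integral_density_1: "integral\<^sup>L lborel \<rho> = 1"
  using total by (simp add: has_bochner_integral_iff)

lemma borel_density [measurable]: "\<rho> \<in> borel_measurable borel"
  using borel_measurable_integrable[OF integrable_density] by simp

lemma integrable_by_moment:
  assumes "f \<in> borel_measurable borel" "\<And>s. \<bar>f s\<bar> \<le> a + \<bar>s\<bar>"
  shows "integrable lborel (\<lambda>s. f s * \<rho> s)"
proof (rule Bochner_Integration.integrable_bound)
  show "integrable lborel (\<lambda>s. a * \<rho> s + \<bar>s\<bar> * \<rho> s)"
    by (intro Bochner_Integration.integrable_add integrable_mult_right integrable_density moment)
  show "(\<lambda>s. f s * \<rho> s) \<in> borel_measurable lborel" using assms(1) by simp
  show "AE s in lborel. norm (f s * \<rho> s) \<le> norm (a * \<rho> s + \<bar>s\<bar> * \<rho> s)"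
  proof (rule AE_I2)
    fix s
    have "\<bar>f s\<bar> * \<rho> s \<le> (a + \<bar>s\<bar>) * \<rho> s" using assms(2) nonneg by (intro mult_right_mono) auto
    then show "norm (f s * \<rho> s) \<le> norm (a * \<rho> s + \<bar>s\<bar> * \<rho> s)"
      using nonneg[of s] by (simp add: abs_mult distrib_right)
  qed
qed

lemma integrable_conv: "integrable lborel (\<lambda>s. max (\<eta> - s) 0 * \<rho> s)"
  by (rule integrable_by_moment[of _ "\<bar>\<eta>\<bar>"]) auto

lemma integrable_tail: "integrable lborel (\<lambda>s. max (s - \<eta>) 0 * \<rho> s)"
  by (rule integrable_by_moment[of _ "\<bar>\<eta>\<bar>"]) auto

lemma integrable_indicator_density: "A \<in> sets borel \<Longrightarrow> integrable lborel (\<lambda>s. indicator A s * \<rho> s)"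
  using integrable_mult_indicator[of A lborel \<rho>] integrable_density by simp

sublocale law: real_distribution law
proof -
  have "emeasure law (space law) = (\<integral>\<^sup>+ s. ennreal (\<rho> s) \<partial>lborel)"
    by (simp add: emeasure_density)
  also have "\<dots> = 1"
    using nn_integral_eq_integral[OF integrable_density] nonneg by (simp add: integral_density_1)
  finally have "prob_space law" by (rule prob_spaceI)
  then show "real_distribution law"
    by (simp add: real_distribution_def real_distribution_axioms_def)
qed

lemma cdf_eq: "cdf law a = (LINT s|lborel. indicator {..a} s * \<rho> s)"
proof -
  have "cdf law a = (LINT s|law. indicator {..a} s)" by (simp add: cdf_def)
  also have "\<dots> = (LINT s|lborel. \<rho> s * indicator {..a} s)"
    using nonneg by (intro integral_real_density) auto
  finally show ?thesis by (simp add: mult.commute)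
qed

lemma isCont_cdf: "isCont (cdf law) x"
proof -
  have "{x} \<in> null_sets law"
    using absolutely_continuousI_density[of "\<lambda>s. ennreal (\<rho> s)" lborel] finite_imp_null_set_lborel[of "{x}"]
    by (auto simp: absolutely_continuous_def)
  then have "measure law {x} = 0" by (rule measure_eq_0_null_sets)
  then show ?thesis by (simp add: law.isCont_cdf)
qed

text \<open>
  Continuity of the distribution function makes its superlevel set closed, so the infimum of
  that set has the property that characterises the quantile.
\<close>

lemma quantile_le_iff:
  assumes "0 < t" "t < 1"
  shows "quantile \<rho> t \<le> a \<longleftrightarrow> t \<le> cdf law a"
proof -
  define S where "S = {a. t \<le> cdf law a}"
  have "\<forall>\<^sub>F a in at_top. t < cdf law a"
    using order_tendstoD(1)[OF law.cdf_lim_at_top_prob] assms by blast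
  then have "S \<noteq> {}"
    unfolding S_def by (auto simp: eventually_at_top_linorder dest: less_imp_le)
  have "\<forall>\<^sub>F a in at_bot. cdf law a < t"
    using order_tendstoD(2)[OF law.cdf_lim_at_bot] assms by blast
  then obtain b where "\<And>a. a \<le> b \<Longrightarrow> cdf law a < t" by (auto simp: eventually_at_bot_linorder)
  then have bdd: "bdd_below S"
    unfolding S_def by (intro bdd_belowI[of _ b]) (metis linear mem_Collect_eq not_le)
  have "closed S"
    unfolding S_def by (intro closed_Collect_le continuous_intros continuous_at_imp_continuous_on) (simp_all add: isCont_cdf)
  then have "Inf S \<in> S" using closed_contains_Inf[OF \<open>S \<noteq> {}\<close> bdd] by simp
  then have Inf: "Inf S \<le> a \<longleftrightarrow> t \<le> cdf law a" for a
    using cInf_lower[OF _ bdd, of a] law.cdf_nondecreasing[of "Inf S" a] by (auto simp: S_def)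
  have "quantile \<rho> t = Inf S"
    unfolding quantile_def
  proof (rule the_equality)
    fix q assume "\<forall>a. q \<le> a \<longleftrightarrow> t \<le> cdf law a"
    with Inf show "q = Inf S" by (metis antisym order_refl)
  qed (use Inf in blast)
  with Inf show ?thesis by simp
qed

lemma cdf_quantile:
  assumes "0 < t" "t < 1"
  shows "cdf law (quantile \<rho> t) = t"
proof (rule antisym)
  show "t \<le> cdf law (quantile \<rho> t)" using quantile_le_iff[OF assms] by blast
  have "(cdf law \<longlongrightarrow> cdf law (quantile \<rho> t)) (at_left (quantile \<rho> t))"
    using isCont_cdf[of "quantile \<rho> t"] by (simp add: isCont_def filterlim_at_split)
  then show "cdf law (quantile \<rho> t) \<le> t"
  proof (rule tendsto_upperbound)
    show "\<forall>\<^sub>F a in at_left (quantile \<rho> t). cdf law a \<le> t"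
      unfolding eventually_at_filter
      by (rule always_eventually) (use quantile_le_iff[OF assms] in \<open>force simp: not_le[symmetric]\<close>)
  qed simp
qed

lemma quantile_mono: "0 < t \<Longrightarrow> t \<le> u \<Longrightarrow> u < 1 \<Longrightarrow> quantile \<rho> t \<le> quantile \<rho> u"
  using quantile_le_iff[of t "quantile \<rho> u"] cdf_quantile[of u] by simp

text \<open>
  The integrated form of \<open>max (x - s) 0 + (y - x) * indicator {..x} s \<le> max (y - s) 0\<close>.
\<close>

lemma cdf_subgradient:
  "conv_smoothing \<rho> x + cdf law x * (y - x) \<le> conv_smoothing \<rho> y"
proof -
  have "conv_smoothing \<rho> x + (y - x) * cdf law x
      = (LINT s|lborel. max (x - s) 0 * \<rho> s + (y - x) * (indicator {..x} s * \<rho> s))"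
    unfolding conv_smoothing_def cdf_eq
    by (subst Bochner_Integration.integral_add) (auto intro: integrable_conv integrable_indicator_density)
  also have "\<dots> \<le> (LINT s|lborel. max (y - s) 0 * \<rho> s)"
  proof (rule integral_mono)
    fix s
    have "(max (x - s) 0 + (y - x) * indicator {..x} s) * \<rho> s \<le> max (y - s) 0 * \<rho> s"
      using nonneg[of s] by (intro mult_right_mono) (auto simp: indicator_def)
    then show "max (x - s) 0 * \<rho> s + (y - x) * (indicator {..x} s * \<rho> s) \<le> max (y - s) 0 * \<rho> s"
      by (simp add: algebra_simps)
  qed (auto intro!: Bochner_Integration.integrable_add integrable_mult_right
      simp: integrable_conv integrable_indicator_density)
  finally show ?thesis by (simp add: conv_smoothing_def mult.commute)
qed

lemma conv_smoothing_nonneg: "0 \<le> conv_smoothing \<rho> \<eta>"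
  unfolding conv_smoothing_def using nonneg by (intro Bochner_Integration.integral_nonneg) auto

text \<open>
  From \<open>max a 0 = a + max (- a) 0\<close>; this exhibits \<open>\<eta> - mean\<close> as the asymptote at infinity.
\<close>

lemma conv_smoothing_eq_tail:
  "conv_smoothing \<rho> \<eta> = \<eta> - mean + (LINT s|lborel. max (s - \<eta>) 0 * \<rho> s)"
proof -
  have i: "integrable lborel (\<lambda>s. s * \<rho> s)" by (rule integrable_by_moment[of _ 0]) auto
  have "conv_smoothing \<rho> \<eta> = (LINT s|lborel. (\<eta> * \<rho> s - s * \<rho> s) + max (s - \<eta>) 0 * \<rho> s)"
    unfolding conv_smoothing_def by (intro Bochner_Integration.integral_cong) (auto simp: max_def algebra_simps)
  also have "\<dots> = \<eta> - mean + (LINT s|lborel. max (s - \<eta>) 0 * \<rho> s)"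
    using i integrable_density integrable_tail
    by (simp add: mean_def integral_density_1)
  finally show ?thesis .
qed

lemma conv_smoothing_ge: "\<eta> - mean \<le> conv_smoothing \<rho> \<eta>"
  unfolding conv_smoothing_eq_tail using nonneg by (auto intro!: Bochner_Integration.integral_nonneg)

lemma conv_smoothing_at_bot: "(conv_smoothing \<rho> \<longlongrightarrow> 0) at_bot"
proof -
  have "((\<lambda>x. LINT s|lborel. max (- x - s) 0 * \<rho> s) \<longlongrightarrow> integral\<^sup>L lborel (\<lambda>s::real. 0)) at_top"
  proof (rule integral_dominated_convergence_at_top[where w = "\<lambda>s. \<bar>s\<bar> * \<rho> s"])
    show "\<forall>\<^sub>F x in at_top. AE s in lborel. norm (max (- x - s) 0 * \<rho> s) \<le> \<bar>s\<bar> * \<rho> s"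
      using eventually_ge_at_top[of 0]
      by eventually_elim (auto simp: abs_mult nonneg intro!: mult_right_mono)
    have "\<forall>\<^sub>F x in at_top. max (- x - s) 0 * \<rho> s = 0" for s
      using eventually_ge_at_top[of "- s"] by eventually_elim auto
    then show "AE s in lborel. ((\<lambda>x. max (- x - s) 0 * \<rho> s) \<longlongrightarrow> 0) at_top"
      by (intro AE_I2 tendsto_eventually)
  qed (auto intro: moment)
  then show ?thesis
    by (simp add: filterlim_at_bot_mirror conv_smoothing_def)
qed

lemma conv_smoothing_at_top: "((\<lambda>\<eta>. \<eta> - conv_smoothing \<rho> \<eta>) \<longlongrightarrow> mean) at_top"
proof -
  have "((\<lambda>x. LINT s|lborel. max (s - x) 0 * \<rho> s) \<longlongrightarrow> integral\<^sup>L lborel (\<lambda>s::real. 0)) at_top"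
  proof (rule integral_dominated_convergence_at_top[where w = "\<lambda>s. \<bar>s\<bar> * \<rho> s"])
    show "\<forall>\<^sub>F x in at_top. AE s in lborel. norm (max (s - x) 0 * \<rho> s) \<le> \<bar>s\<bar> * \<rho> s"
      using eventually_ge_at_top[of 0]
      by eventually_elim (auto simp: abs_mult nonneg intro!: mult_right_mono)
    have "\<forall>\<^sub>F x in at_top. max (s - x) 0 * \<rho> s = 0" for s
      using eventually_ge_at_top[of s] by eventually_elim auto
    then show "AE s in lborel. ((\<lambda>x. max (s - x) 0 * \<rho> s) \<longlongrightarrow> 0) at_top"
      by (intro AE_I2 tendsto_eventually)
  qed (auto intro: moment)
  from tendsto_diff[OF tendsto_const[of mean] this] show ?thesis
    by (simp add: conv_smoothing_eq_tail)
qed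

lemma fenchel_young:
  assumes "0 < t" "t < 1"
  shows "\<eta> * t - conv_dual_interior \<rho> t \<le> conv_smoothing \<rho> \<eta>"
  using cdf_subgradient[of "quantile \<rho> t" \<eta>] cdf_quantile[OF assms]
  by (simp add: conv_dual_interior_def algebra_simps)

text \<open>
  The reverse inequality is the subgradient inequality from \<open>\<eta>\<close> towards the quantile: the
  smoothing is affine between the two points, where the distribution function is constant.
\<close>

lemma fenchel_young_eq:
  assumes "0 < cdf law \<eta>" "cdf law \<eta> < 1"
  shows "\<eta> * cdf law \<eta> - conv_dual_interior \<rho> (cdf law \<eta>) = conv_smoothing \<rho> \<eta>"
  using cdf_subgradient[of \<eta> "quantile \<rho> (cdf law \<eta>)"] fenchel_young[OF assms, of \<eta>]
  by (simp add: conv_dual_interior_def algebra_simps)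

text \<open>
  The Fenchel-Young inequality bounds the dual function from below by
  \<open>\<eta> * t - conv_smoothing \<rho> \<eta>\<close>, which is near \<open>0\<close> for very negative \<open>\<eta>\<close> and then small
  \<open>t\<close>. From above it is bounded by \<open>t * quantile \<rho> t\<close>, where the quantile may tend to
  \<open>- \<infinity>\<close> but is at most the median.
\<close>

lemma conv_dual_interior_at_0: "(conv_dual_interior \<rho> \<longlongrightarrow> 0) (at_right 0)"
proof (rule order_tendstoI)
  fix c :: real assume "c < 0"
  then obtain \<eta> where \<eta>: "conv_smoothing \<rho> \<eta> < - c"
    using order_tendstoD(2)[OF conv_smoothing_at_bot, of "- c"] by (auto simp: eventually_at_bot_linorder)
  have "((\<lambda>t. \<eta> * t - conv_smoothing \<rho> \<eta>) \<longlongrightarrow> \<eta> * 0 - conv_smoothing \<rho> \<eta>) (at_right 0)"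
    by (intro tendsto_intros)
  then have "\<forall>\<^sub>F t in at_right 0. c < \<eta> * t - conv_smoothing \<rho> \<eta>"
    using \<eta> by (intro order_tendstoD(1)) auto
  moreover have "\<forall>\<^sub>F t in at_right (0::real). t \<in> {0<..<1}" by (rule eventually_at_right_real) simp
  ultimately show "\<forall>\<^sub>F t in at_right 0. c < conv_dual_interior \<rho> t"
  proof eventually_elim
    case (elim t)
    with fenchel_young[of t \<eta>] show ?case by simp
  qed
next
  fix c :: real assume "0 < c"
  have "((\<lambda>t. t * quantile \<rho> (1/2)) \<longlongrightarrow> 0 * quantile \<rho> (1/2)) (at_right 0)"
    by (intro tendsto_intros)
  then have "\<forall>\<^sub>F t in at_right 0. t * quantile \<rho> (1/2) < c"
    using \<open>0 < c\<close> by (intro order_tendstoD(2)) auto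
  moreover have "\<forall>\<^sub>F t in at_right (0::real). t \<in> {0<..<1/2}" by (rule eventually_at_right_real) simp
  ultimately show "\<forall>\<^sub>F t in at_right 0. conv_dual_interior \<rho> t < c"
  proof eventually_elim
    case (elim t)
    then have "t * quantile \<rho> t \<le> t * quantile \<rho> (1/2)"
      by (intro mult_left_mono quantile_mono) auto
    with elim conv_smoothing_nonneg[of "quantile \<rho> t"] show ?case
      unfolding conv_dual_interior_def by linarith
  qed
qed

text \<open>
  As at \<open>0\<close>, with the asymptote \<open>\<eta> - mean\<close> in place of \<open>0\<close>.
\<close>

lemma conv_dual_interior_at_1: "(conv_dual_interior \<rho> \<longlongrightarrow> mean) (at_left 1)"
proof (rule order_tendstoI)
  fix c :: real assume "c < mean"
  then obtain \<eta> where \<eta>: "c < \<eta> - conv_smoothing \<rho> \<eta>"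
    using order_tendstoD(1)[OF conv_smoothing_at_top, of c] by (auto simp: eventually_at_top_linorder)
  have "((\<lambda>t. \<eta> * t - conv_smoothing \<rho> \<eta>) \<longlongrightarrow> \<eta> * 1 - conv_smoothing \<rho> \<eta>) (at_left 1)"
    by (intro tendsto_intros)
  then have "\<forall>\<^sub>F t in at_left 1. c < \<eta> * t - conv_smoothing \<rho> \<eta>"
    using \<eta> by (intro order_tendstoD(1)) auto
  moreover have "\<forall>\<^sub>F t in at_left (1::real). t \<in> {0<..<1}" by (rule eventually_at_left_real) simp
  ultimately show "\<forall>\<^sub>F t in at_left 1. c < conv_dual_interior \<rho> t"
  proof eventually_elim
    case (elim t)
    with fenchel_young[of t \<eta>] show ?case by simp
  qed
next
  fix c :: real assume "mean < c"
  have "((\<lambda>t. mean - (1 - t) * quantile \<rho> (1/2)) \<longlongrightarrow> mean - (1 - 1) * quantile \<rho> (1/2)) (at_left 1)"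
    by (intro tendsto_intros)
  then have "\<forall>\<^sub>F t in at_left 1. mean - (1 - t) * quantile \<rho> (1/2) < c"
    using \<open>mean < c\<close> by (intro order_tendstoD(2)) auto
  moreover have "\<forall>\<^sub>F t in at_left (1::real). t \<in> {1/2<..<1}" by (rule eventually_at_left_real) simp
  ultimately show "\<forall>\<^sub>F t in at_left 1. conv_dual_interior \<rho> t < c"
  proof eventually_elim
    case (elim t)
    then have "(1 - t) * quantile \<rho> (1/2) \<le> (1 - t) * quantile \<rho> t"
      by (intro mult_left_mono quantile_mono) auto
    with elim conv_smoothing_ge[of "quantile \<rho> t"] show ?case
      by (simp add: conv_dual_interior_def algebra_simps)
  qed
qed

lemma conv_dual_0: "conv_dual \<rho> 0 = 0"
  by (simp add: conv_dual_def tendsto_Lim[OF _ conv_dual_interior_at_0])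

lemma conv_dual_1: "conv_dual \<rho> 1 = mean"
  by (simp add: conv_dual_def tendsto_Lim[OF _ conv_dual_interior_at_1])

text \<open>
  The maximiser is \<open>cdf law \<eta>\<close>. Where it is \<open>0\<close> or \<open>1\<close>, the point \<open>\<eta>\<close> lies outside the
  range of the quantiles, and the subgradient inequality shows that the smoothing already
  coincides with its asymptote.
\<close>

theorem conv_smoothing_is_maximum:
  "is_maximum (\<lambda>t. \<eta> * t - conv_dual \<rho> t) {0..1} (conv_smoothing \<rho> \<eta>)"
  unfolding is_maximum_def
proof (intro conjI ballI)
  fix t :: real assume "t \<in> {0..1}"
  then consider "t = 0" | "t = 1" | "0 < t" "t < 1" by fastforce
  then show "\<eta> * t - conv_dual \<rho> t \<le> conv_smoothing \<rho> \<eta>"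
  proof cases
    case 3
    with fenchel_young[OF 3, of \<eta>] show ?thesis by (simp add: conv_dual_def)
  qed (auto simp: conv_dual_0 conv_dual_1 conv_smoothing_nonneg conv_smoothing_ge)
next
  consider "cdf law \<eta> = 0" | "cdf law \<eta> = 1" | "0 < cdf law \<eta>" "cdf law \<eta> < 1"
    using law.cdf_nonneg[of \<eta>] law.cdf_bounded_prob[of \<eta>] by fastforce
  then show "\<exists>t\<in>{0..1}. \<eta> * t - conv_dual \<rho> t = conv_smoothing \<rho> \<eta>"
  proof cases
    case 1
    then have "conv_smoothing \<rho> \<eta> \<le> conv_smoothing \<rho> x" for x using cdf_subgradient[of \<eta> x] by simp
    then have "conv_smoothing \<rho> \<eta> \<le> 0" by (intro tendsto_lowerbound[OF conv_smoothing_at_bot]) auto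
    with conv_smoothing_nonneg[of \<eta>] show ?thesis by (intro bexI[of _ 0]) (auto simp: conv_dual_0)
  next
    case 2
    then have "x - conv_smoothing \<rho> x \<le> \<eta> - conv_smoothing \<rho> \<eta>" for x
      using cdf_subgradient[of \<eta> x] by simp
    then have "mean \<le> \<eta> - conv_smoothing \<rho> \<eta>" by (intro tendsto_upperbound[OF conv_smoothing_at_top]) auto
    with conv_smoothing_ge[of \<eta>] show ?thesis by (intro bexI[of _ 1]) (auto simp: conv_dual_1)
  next
    case 3
    with fenchel_young_eq[OF 3] show ?thesis
      by (intro bexI[of _ "cdf law \<eta>"]) (auto simp: conv_dual_def)
  qed
qed

lemma conv_smoothing_eq_set_integral:
  "conv_smoothing \<rho> \<eta> = (LINT s:{..\<eta>}|lborel. (\<eta> - s) * \<rho> s)"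
  unfolding conv_smoothing_def set_lebesgue_integral_def
  by (intro Bochner_Integration.integral_cong) (auto simp: indicator_def max_def)

end

section \<open>The two smoothings\<close>

theorem proposition7:
  "(\<forall>\<rho> :: real \<Rightarrow> real.
      continuous_on UNIV \<rho> \<and> (\<forall>s. 0 \<le> \<rho> s) \<and> has_bochner_integral lborel \<rho> 1 \<and>
      integrable lborel (\<lambda>s. \<bar>s\<bar> * \<rho> s) \<longrightarrow>
        (conv_dual_interior \<rho> \<longlongrightarrow> conv_dual \<rho> 0) (at_right 0) \<and>
        (conv_dual_interior \<rho> \<longlongrightarrow> conv_dual \<rho> 1) (at_left 1) \<and>
        (\<forall>\<eta>. conv_smoothing \<rho> \<eta> = (LINT s:{..\<eta>}|lborel. (\<eta> - s) * \<rho> s) \<and>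
             is_maximum (\<lambda>t. \<eta> * t - conv_dual \<rho> t) {0..1} (conv_smoothing \<rho> \<eta>)))
   \<and>
   (\<forall>(n :: nat) (p :: real) (d :: real \<Rightarrow> real) (m :: real \<Rightarrow> real).
      1 \<le> n \<and> 0 < p \<and> p < 1 \<and> {0..1 / (real n * (1 - p))} \<subseteq> {0..1} \<and>
      strongly_convex_on {0..1} d \<and>
      (\<forall>\<eta>. is_maximum (\<lambda>t. \<eta> * t - scaled_dual n p d t) {0..1} (m \<eta>)) \<longrightarrow>
        (\<forall>s. m differentiable (at s)) \<and>
        (AE s in lebesgue. deriv m differentiable (at s)) \<and>
        (\<exists>L. (m \<longlongrightarrow> L) at_bot \<and>
          (\<forall>\<rho> :: real \<Rightarrow> real.
             (AE s in lebesgue. (deriv m has_real_derivative \<rho> s) (at s)) \<longrightarrow>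
               (AE s in lebesgue. 0 \<le> \<rho> s) \<and> has_bochner_integral lebesgue \<rho> 1 \<and>
               (\<forall>\<eta>. set_integrable lebesgue {..\<eta>} (\<lambda>s. (\<eta> - s) * \<rho> s) \<and>
                    m \<eta> = L + (LINT s:{..\<eta>}|lebesgue. (\<eta> - s) * \<rho> s)))))"
proof (intro conjI allI impI, goal_cases)
  case (1 \<rho>)
  then interpret first_moment_density \<rho> by unfold_locales auto
  show ?case using conv_dual_interior_at_0 by (simp add: conv_dual_0)
next
  case (2 \<rho>)
  then interpret first_moment_density \<rho> by unfold_locales auto
  show ?case using conv_dual_interior_at_1 by (simp add: conv_dual_1)
next
  case (3 \<rho> \<eta>)
  then interpret first_moment_density \<rho> by unfold_locales auto
  show ?case by (rule conv_smoothing_eq_set_integral)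
next
  case (4 \<rho> \<eta>)
  then interpret first_moment_density \<rho> by unfold_locales auto
  show ?case by (rule conv_smoothing_is_maximum)
next
  case (5 n p d m s)
  then have "strongly_convex_on {0..1} (scaled_dual n p d)"
    by (intro strongly_convex_scaled_dual) auto
  with 5 show ?case by (intro strongly_convex_conjugate_is_convolution(1)) auto
next
  case (6 n p d m)
  then have "strongly_convex_on {0..1} (scaled_dual n p d)"
    by (intro strongly_convex_scaled_dual) auto
  with 6 show ?case by (intro strongly_convex_conjugate_is_convolution(2)) auto
next
  case (7 n p d m)
  then have "strongly_convex_on {0..1} (scaled_dual n p d)"
    by (intro strongly_convex_scaled_dual) auto
  with 7 show ?case by (intro strongly_convex_conjugate_is_convolution(3)) auto
qed

end
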